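(* Let $I$ be a finite index set and let $\{\tau_i\}_{i\in I}$ be an affine contractive IFS on $\mathbb{R}$, with $\tau_i(x)=c_ix+b_i$. Let $\{p_i\}_{i\in I}$ be probability weights with $p_i\in(0,1)$ and $\sum_{i\in I} p_i=1$, and for each $i\in I$ let $A_i$ be the infinite upper triangular matrix with entries $$(A_i)_{m,n}=\binom{n}{m}c_i^{m}b_i^{n-m}\ \text{ for } 0\le m\le n,\qquad (A_i)_{m,n}=0\ \text{ for } m>n.$$ Then the moment matrix transformation $$M^{(\nu)}\mapsto\sum_{i\in I}p_i\,A_i^*M^{(\nu)}A_i$$ has a unique fixed point among moment matrices of probability measures. Moreover, the fixed point is the moment matrix $M^{(\mu)}$ of the Hutchinson equilibrium measure $\mu$ of the IFS.
   Context: Contractive means $|c_i|<1$ for each $i$. For a Borel probability measure $\nu$ on $\mathbb{R}$ with finite moments of all orders, $M^{(\nu)}$ is the infinite matrix with entries $M^{(\nu)}_{m,n}=\int_{\mathbb{R}}x^{m+n}\,\mathrm{d}\nu(x)$, $m,n\in\mathbb{N}_0$. $A_i^*$ is the conjugate transpose; since $A_i$ is upper triangular, all entries of $A_i^*M^{(\nu)}A_i$ are finite sums. The Hutchinson equilibrium measure is the unique Borel probability measure $\mu$ on $\mathbb{R}$ with $\mu=\sum_{i\in I}p_i(\mu\circ\tau_i^{-1})$. The convention $0^0=1$ is used. *)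

theory Defs
  imports "HOL-Probability.Probability"
begin

text \<open>Infinite matrices with rows and columns indexed by \<open>\<nat>\<^sub>0\<close>. All matrices here are real, so
  the conjugate transpose is the transpose. Products are formed as series; in
  \<open>A\<^sup>* M A\<close> with \<open>A\<close> upper triangular each of these series has finitely many nonzero terms.\<close>

type_synonym imat = "nat \<Rightarrow> nat \<Rightarrow> real"

definition imat_mult :: "imat \<Rightarrow> imat \<Rightarrow> imat" where
  "imat_mult A B = (\<lambda>m n. \<Sum>k. A m k * B k n)"

definition imat_adjoint :: "imat \<Rightarrow> imat" where
  "imat_adjoint A = (\<lambda>m n. A n m)"

definition finite_moments :: "real measure \<Rightarrow> bool" where
  "finite_moments \<nu> \<longleftrightarrow> (\<forall>k::nat. integrable \<nu> (\<lambda>x. x ^ k))"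

definition moment_matrix :: "real measure \<Rightarrow> imat" where
  "moment_matrix \<nu> = (\<lambda>m n. \<integral>x. x ^ (m + n) \<partial>\<nu>)"

definition moment_matrices :: "imat set" where
  "moment_matrices = {moment_matrix \<nu> | \<nu>. real_distribution \<nu> \<and> finite_moments \<nu>}"

definition affine_matrix :: "real \<Rightarrow> real \<Rightarrow> imat" where
  "affine_matrix c b =
     (\<lambda>m n. if m \<le> n then real (n choose m) * c ^ m * b ^ (n - m) else 0)"

definition moment_transform ::
  "'i set \<Rightarrow> ('i \<Rightarrow> real) \<Rightarrow> ('i \<Rightarrow> imat) \<Rightarrow> imat \<Rightarrow> imat" where
  "moment_transform I p A M =
     (\<lambda>m n. \<Sum>i\<in>I. p i * imat_mult (imat_mult (imat_adjoint (A i)) M) (A i) m n)"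

text \<open>The equation \<open>\<mu> = (\<Sum>i\<in>I. p\<^sub>i (\<mu> \<circ> \<tau>\<^sub>i\<^sup>-\<^sup>1))\<close> between Borel measures is stated
  as equality on Borel sets.\<close>

definition equilibrium_measure ::
  "'i set \<Rightarrow> ('i \<Rightarrow> real) \<Rightarrow> ('i \<Rightarrow> real \<Rightarrow> real) \<Rightarrow> real measure \<Rightarrow> bool" where
  "equilibrium_measure I p \<tau> \<mu> \<longleftrightarrow>
     real_distribution \<mu> \<and>
     (\<forall>B\<in>sets borel. measure \<mu> B = (\<Sum>i\<in>I. p i * measure (distr \<mu> borel (\<tau> i)) B))"

definition hutchinson_measure ::
  "'i set \<Rightarrow> ('i \<Rightarrow> real) \<Rightarrow> ('i \<Rightarrow> real \<Rightarrow> real) \<Rightarrow> real measure" where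
  "hutchinson_measure I p \<tau> = (THE \<mu>. equilibrium_measure I p \<tau> \<mu>)"

end

theory Submission
  imports Defs
begin

text \<open>The transform sends the moment matrix of \<open>\<nu>\<close> to that of \<open>\<Sum>i. p\<^sub>i (\<nu> \<circ> \<tau>\<^sub>i\<^sup>-\<^sup>1)\<close>, so the
  equilibrium measure gives a fixed point. Conversely, the fixed-point equation
  expresses \<open>(1 - \<Sum>i. p\<^sub>i c\<^sub>i\<^sup>k)\<close> times the \<open>k\<close>-th moment through the lower moments, and this
  factor is nonzero for \<open>k \<ge> 1\<close>; hence the moments are determined recursively from the zeroth.

  The equilibrium measure is the law of the bounded random series
  \<open>\<Sum>k. c\<^bsub>\<omega>(0)\<^esub> \<cdots> c\<^bsub>\<omega>(k-1)\<^esub> b\<^bsub>\<omega>(k)\<^esub>\<close> with independent indices \<open>\<omega>(k)\<close> of law \<open>p\<close>. It is unique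
  because the difference \<open>D\<close> of two characteristic functions satisfies
  \<open>\<bar>D t\<bar> \<le> \<Sum>i. p\<^sub>i \<bar>D (c\<^sub>i t)\<bar>\<close> and is continuous with \<open>D 0 = 0\<close>.\<close>

section \<open>Integrals against an equilibrium measure\<close>

text \<open>Turning the weights into a \<open>pmf\<close> makes the index a random variable, so
  mixtures become pushforwards of product measures and independent index sequences are available.
  The weights are fixed only on \<open>I\<close>, hence the extension by 0.\<close>

lemma obtain_pmf_with_weights:
  fixes p :: "'i \<Rightarrow> real"
  assumes "finite I" "\<And>i. i \<in> I \<Longrightarrow> 0 < p i" "(\<Sum>i\<in>I. p i) = 1"
  obtains q where "set_pmf q = I" "\<And>i. i \<in> I \<Longrightarrow> pmf q i = p i"
proof
  define p' where "p' i = (if i \<in> I then p i else 0)" for i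
  have nonneg: "0 \<le> p' i" for i
    using assms(2)[of i] by (auto simp: p'_def)
  have "(\<integral>\<^sup>+i. ennreal (p' i) \<partial>count_space UNIV) = (\<Sum>i\<in>I. ennreal (p' i))"
    using assms(1) by (intro nn_integral_count_space') (auto simp: p'_def)
  also have "\<dots> = 1"
    using assms(3) by (subst sum_ennreal[OF nonneg]) (simp add: p'_def)
  finally have total: "(\<integral>\<^sup>+i. ennreal (p' i) \<partial>count_space UNIV) = 1" .
  show "set_pmf (embed_pmf p') = I"
    using assms(2) by (subst set_embed_pmf[OF nonneg total]) (force simp: p'_def)
  show "pmf (embed_pmf p') i = p i" if "i \<in> I" for i
    using that by (simp add: pmf_embed_pmf[OF nonneg total] p'_def)
qed

text \<open>The pushforward realises the convex combination of the image measures as one measure: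
  draw the index from \<open>q\<close>, then the point from \<mu>. Fubini and the finite support of
  \<open>q\<close> give the sum.\<close>

lemma integral_mixture_affine:
  fixes f :: "real \<Rightarrow> 'e::{banach, second_countable_topology}" and q :: "'i pmf"
  assumes "real_distribution \<mu>" "finite (set_pmf q)"
    and f: "integrable (distr (measure_pmf q \<Otimes>\<^sub>M \<mu>) borel (\<lambda>(i, x). c i * x + b i)) f"
  shows "(\<integral>x. f x \<partial>distr (measure_pmf q \<Otimes>\<^sub>M \<mu>) borel (\<lambda>(i, x). c i * x + b i)) =
    (\<Sum>i\<in>set_pmf q. pmf q i *\<^sub>R (\<integral>x. f (c i * x + b i) \<partial>\<mu>))"
proof -
  interpret real_distribution \<mu> by fact
  interpret P: pair_prob_space "measure_pmf q" \<mu> ..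
  have [measurable]: "c \<in> borel_measurable (measure_pmf q)" "b \<in> borel_measurable (measure_pmf q)"
    by auto
  have [measurable]: "f \<in> borel_measurable borel"
    using borel_measurable_integrable[OF f] by simp
  have "integrable (measure_pmf q \<Otimes>\<^sub>M \<mu>) (\<lambda>(i, x). f (c i * x + b i))"
    using f by (subst (asm) integrable_distr_eq) (simp_all add: case_prod_beta')
  then have "(\<integral>z. (\<lambda>(i, x). f (c i * x + b i)) z \<partial>(measure_pmf q \<Otimes>\<^sub>M \<mu>)) =
      (\<integral>i. (\<integral>x. f (c i * x + b i) \<partial>\<mu>) \<partial>measure_pmf q)"
    by (subst P.integral_fst'[symmetric]) auto
  also have "\<dots> = (\<Sum>i\<in>set_pmf q. pmf q i *\<^sub>R (\<integral>x. f (c i * x + b i) \<partial>\<mu>))"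
    using assms(2) by (intro integral_measure_pmf) auto
  finally show ?thesis
    by (subst integral_distr) (auto simp: case_prod_beta)
qed

text \<open>The defining equation concerns Borel sets only; this carries it over to integrable
  functions. Banach-valued \<open>f\<close> covers both the complex exponentials of characteristic
  functions and the real powers of moments.\<close>

lemma integral_equilibrium_measure:
  fixes f :: "real \<Rightarrow> 'e::{banach, second_countable_topology}" and p :: "'i \<Rightarrow> real"
  assumes I: "finite I" "\<And>i. i \<in> I \<Longrightarrow> 0 < p i" "(\<Sum>i\<in>I. p i) = 1"
    and \<tau>: "\<And>i x. i \<in> I \<Longrightarrow> \<tau> i x = c i * x + b i"
    and eq: "equilibrium_measure I p \<tau> \<mu>" and f: "integrable \<mu> f"
  shows "(\<integral>x. f x \<partial>\<mu>) = (\<Sum>i\<in>I. p i *\<^sub>R (\<integral>x. f (\<tau> i x) \<partial>\<mu>))"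
proof -
  have \<mu>: "real_distribution \<mu>"
    using eq by (simp add: equilibrium_measure_def)
  interpret real_distribution \<mu> by fact
  obtain q where q: "set_pmf q = I" "\<And>i. i \<in> I \<Longrightarrow> pmf q i = p i"
    using obtain_pmf_with_weights I by metis
  interpret P: pair_prob_space "measure_pmf q" \<mu> ..
  have [measurable]: "c \<in> borel_measurable (measure_pmf q)" "b \<in> borel_measurable (measure_pmf q)"
    by auto
  have \<tau>_meas: "\<tau> i \<in> borel_measurable borel" if "i \<in> I" for i
    using \<tau>[OF that] by (simp add: measurable_cong[of borel "\<tau> i"])
  let ?N = "distr (measure_pmf q \<Otimes>\<^sub>M \<mu>) borel (\<lambda>(i, x). c i * x + b i)"
  interpret N: prob_space ?N
    by (rule P.prob_space_distr) simp
  \<comment> \<open>Applied to indicators, the mixture formula is exactly the right-hand side of the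
    equilibrium equation.\<close>
  have "\<mu> = ?N"
  proof (rule measure_eqI)
    fix B assume "B \<in> sets \<mu>"
    then have B[measurable]: "B \<in> sets borel" by simp
    have "measure ?N B = (\<integral>x. indicator B x \<partial>?N)"
      by simp
    also have "\<dots> = (\<Sum>i\<in>I. p i * (\<integral>x. indicator B (c i * x + b i) \<partial>\<mu>))"
      using integral_mixture_affine[OF \<mu>, of q c b "indicator B :: real \<Rightarrow> real"] I q
      by (simp add: integrable_indicator_iff less_top[symmetric])
    also have "\<dots> = (\<Sum>i\<in>I. p i * measure (distr \<mu> borel (\<tau> i)) B)"
    proof (intro sum.cong refl arg_cong[where f = "(*) _"])
      fix i assume i: "i \<in> I"
      have "measure (distr \<mu> borel (\<tau> i)) B = (\<integral>x. indicator B x \<partial>distr \<mu> borel (\<tau> i))"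
        by simp
      also have "\<dots> = (\<integral>x. indicator B (c i * x + b i) \<partial>\<mu>)"
        using \<tau>_meas[OF i] \<tau>[OF i] by (subst integral_distr) auto
      finally show "(\<integral>x. indicator B (c i * x + b i) \<partial>\<mu>) = measure (distr \<mu> borel (\<tau> i)) B" ..
    qed
    also have "\<dots> = measure \<mu> B"
      using eq B by (simp add: equilibrium_measure_def)
    finally show "emeasure \<mu> B = emeasure ?N B"
      by (simp add: emeasure_eq_measure N.emeasure_eq_measure)
  qed simp
  then show ?thesis
    using integral_mixture_affine[OF \<mu>, of q c b f] I f q \<tau> by simp
qed

section \<open>Uniqueness of the equilibrium measure\<close>

lemma obtain_contraction_bound:
  fixes c :: "'i \<Rightarrow> real"
  assumes "finite I" "\<And>i. i \<in> I \<Longrightarrow> \<bar>c i\<bar> < 1"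
  obtains C where "0 \<le> C" "C < 1" "\<And>i. i \<in> I \<Longrightarrow> \<bar>c i\<bar> \<le> C"
proof
  \<comment> \<open>Inserting 0 makes the bound nonnegative and keeps \<open>Max\<close> applied to
    a nonempty set.\<close>
  let ?C = "Max (insert 0 ((\<lambda>i. \<bar>c i\<bar>) ` I))"
  show "0 \<le> ?C" "\<And>i. i \<in> I \<Longrightarrow> \<bar>c i\<bar> \<le> ?C"
    using assms by (auto intro!: Max_ge)
  show "?C < 1"
    using assms by (subst Max_less_iff) auto
qed

lemma equilibrium_measure_unique:
  fixes p c b :: "'i \<Rightarrow> real"
  assumes I: "finite I" "\<And>i. i \<in> I \<Longrightarrow> 0 < p i" "(\<Sum>i\<in>I. p i) = 1"
    and \<tau>: "\<And>i x. i \<in> I \<Longrightarrow> \<tau> i x = c i * x + b i"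
    and c: "\<And>i. i \<in> I \<Longrightarrow> \<bar>c i\<bar> < 1"
    and eq: "equilibrium_measure I p \<tau> \<mu>" "equilibrium_measure I p \<tau> \<nu>"
  shows "\<mu> = \<nu>"
proof -
  obtain C where C: "0 \<le> C" "C < 1" "\<And>i. i \<in> I \<Longrightarrow> \<bar>c i\<bar> \<le> C"
    using obtain_contraction_bound[where c = c, OF I(1) c] by blast
  interpret \<mu>: real_distribution \<mu>
    using eq(1) by (simp add: equilibrium_measure_def)
  interpret \<nu>: real_distribution \<nu>
    using eq(2) by (simp add: equilibrium_measure_def)
  have char_eq: "char \<kappa> t = (\<Sum>i\<in>I. p i *\<^sub>R (iexp (t * b i) * char \<kappa> (t * c i)))"
    if \<kappa>: "equilibrium_measure I p \<tau> \<kappa>" for \<kappa> t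
  proof -
    interpret real_distribution \<kappa>
      using \<kappa> by (simp add: equilibrium_measure_def)
    have "char \<kappa> t = (\<Sum>i\<in>I. p i *\<^sub>R (\<integral>x. iexp (t * \<tau> i x) \<partial>\<kappa>))"
      unfolding char_def
      by (rule integral_equilibrium_measure[OF I \<tau> \<kappa>]) (auto intro!: integrable_iexp)
    also have "\<dots> = (\<Sum>i\<in>I. p i *\<^sub>R (\<integral>x. iexp (t * b i) * iexp (t * c i * x) \<partial>\<kappa>))"
      by (intro sum.cong refl arg_cong[where f = "scaleR _"] Bochner_Integration.integral_cong)
         (simp_all add: \<tau> exp_add[symmetric] algebra_simps)
    also have "\<dots> = (\<Sum>i\<in>I. p i *\<^sub>R (iexp (t * b i) * char \<kappa> (t * c i)))"
      unfolding char_def by simp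
    finally show ?thesis .
  qed
  define D where "D t = cmod (char \<mu> t - char \<nu> t)" for t
  \<comment> \<open>The translations contribute only phases \<open>iexp (t * b i)\<close> of modulus
    1, which vanish under the norm.\<close>
  have D_le: "D t \<le> (\<Sum>i\<in>I. p i * D (t * c i))" for t
  proof -
    have "D t = cmod (\<Sum>i\<in>I. p i *\<^sub>R (iexp (t * b i) * (char \<mu> (t * c i) - char \<nu> (t * c i))))"
      unfolding D_def char_eq[OF eq(1), of t] char_eq[OF eq(2), of t]
      by (simp add: sum_subtractf[symmetric] algebra_simps)
    also have "\<dots> \<le> (\<Sum>i\<in>I. p i * D (t * c i))"
      unfolding D_def using I(2)
      by (intro sum_norm_le) (simp add: norm_mult less_imp_le abs_of_pos)
    finally show ?thesis .
  qed
  have D_small: "D t \<le> \<epsilon>" if "0 < \<epsilon>" for t \<epsilon>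
  proof -
    have "isCont D 0"
      unfolding D_def by (intro continuous_intros \<mu>.isCont_char \<nu>.isCont_char)
    moreover have "D 0 = 0"
      by (simp add: D_def \<mu>.char_zero \<nu>.char_zero)
    ultimately obtain \<delta> where \<delta>: "0 < \<delta>" "\<And>s. \<bar>s\<bar> < \<delta> \<Longrightarrow> D s < \<epsilon>"
      using \<open>0 < \<epsilon>\<close> unfolding continuous_at_eps_delta
      by (fastforce simp: dist_real_def D_def)
    \<comment> \<open>Here \<open>n\<close> counts the uses of \<open>D_le\<close>: each shrinks the
      argument by a factor of at most \<open>C\<close>, until it lies where continuity at 0 gives
      the bound. The weights sum to 1, so \<epsilon> does not grow.\<close>
    have step: "D s \<le> \<epsilon>" if "C ^ n * \<bar>s\<bar> < \<delta>" for n s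
      using that
    proof (induction n arbitrary: s)
      case 0
      then show ?case using \<delta>(2)[of s] by simp
    next
      case (Suc n)
      have "D (s * c i) \<le> \<epsilon>" if "i \<in> I" for i
      proof (rule Suc.IH)
        have "C ^ n * \<bar>s * c i\<bar> \<le> C ^ n * (\<bar>s\<bar> * C)"
          unfolding abs_mult using C that by (intro mult_left_mono) auto
        also have "\<dots> < \<delta>"
          using Suc.prems by (simp add: mult_ac)
        finally show "C ^ n * \<bar>s * c i\<bar> < \<delta>" .
      qed
      then have "(\<Sum>i\<in>I. p i * D (s * c i)) \<le> (\<Sum>i\<in>I. p i * \<epsilon>)"
        using I(2) by (intro sum_mono mult_left_mono) (auto simp: less_imp_le)
      also have "\<dots> = \<epsilon>"
        using I(3) by (simp add: sum_distrib_right[symmetric])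
      finally show ?case
        using D_le[of s] by linarith
    qed
    have "(\<lambda>n. C ^ n * \<bar>t\<bar>) \<longlonglongrightarrow> 0 * \<bar>t\<bar>"
      using C by (intro tendsto_intros LIMSEQ_realpow_zero)
    then have "eventually (\<lambda>n. C ^ n * \<bar>t\<bar> < \<delta>) sequentially"
      using \<delta>(1) by (intro order_tendstoD) auto
    then show ?thesis
      using step by (auto simp: eventually_sequentially)
  qed
  have "char \<mu> = char \<nu>"
  proof
    fix t
    have "D t \<le> 0"
      using D_small by (rule field_le_epsilon) simp
    then show "char \<mu> t = char \<nu> t"
      by (simp add: D_def)
  qed
  then show ?thesis
    by (intro Levy_uniqueness) unfold_locales
qed

section \<open>Existence of the equilibrium measure\<close>

text \<open>This is the coding map of the IFS: the partial sums are the compositions of the maps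
  with indices \<open>\<omega> !! 0\<close>, \<open>\<omega> !! 1\<close>, and so on, the first
  outermost, evaluated at 0.\<close>

definition affine_address :: "('i \<Rightarrow> real) \<Rightarrow> ('i \<Rightarrow> real) \<Rightarrow> 'i stream \<Rightarrow> real" where
  "affine_address c b \<omega> = (\<Sum>k. (\<Prod>j<k. c (\<omega> !! j)) * b (\<omega> !! k))"

context
  fixes c b :: "'i \<Rightarrow> real" and B C :: real
  assumes C: "C < 1" and c: "\<And>i. \<bar>c i\<bar> \<le> C" and b: "\<And>i. \<bar>b i\<bar> \<le> B"
begin

lemma affine_address_term_le:
  "norm ((\<Prod>j<k. c (\<omega> !! j)) * b (\<omega> !! k)) \<le> B * C ^ k"
proof -
  have "0 \<le> C" "0 \<le> B"
    using abs_ge_zero c b order_trans by blast+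
  have "(\<Prod>j<k. \<bar>c (\<omega> !! j)\<bar>) \<le> (\<Prod>j<k. C)"
    by (intro prod_mono) (simp add: c)
  then have "(\<Prod>j<k. \<bar>c (\<omega> !! j)\<bar>) * \<bar>b (\<omega> !! k)\<bar> \<le> C ^ k * B"
    using \<open>0 \<le> C\<close> by (intro mult_mono b) auto
  then show ?thesis
    by (simp add: abs_mult abs_prod mult.commute)
qed

lemma summable_geometric_bound: "summable (\<lambda>k. B * C ^ k)"
proof -
  have "0 \<le> C"
    using abs_ge_zero c order_trans by blast
  with C show ?thesis
    by (intro summable_mult summable_geometric) simp
qed

text \<open>The bound does not depend on \<omega>, so the law of the address has bounded support and
  hence moments of all orders.\<close>

lemma abs_affine_address_le: "\<bar>affine_address c b \<omega>\<bar> \<le> (\<Sum>k. B * C ^ k)"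
proof -
  have *: "summable (\<lambda>k. norm ((\<Prod>j<k. c (\<omega> !! j)) * b (\<omega> !! k)))"
    by (intro summable_norm_comparison_test[OF _ summable_geometric_bound] exI allI impI
        affine_address_term_le)
  show ?thesis
    unfolding affine_address_def real_norm_def[symmetric]
    by (rule order_trans[OF summable_norm[OF *]])
       (rule suminf_le[OF affine_address_term_le * summable_geometric_bound])
qed

text \<open>The head term is \<open>b i\<close>, its product being empty, and all later terms share
  the factor \<open>c i\<close>. Prepending an index thus acts on addresses as the corresponding
  affine map.\<close>

lemma affine_address_Stream:
  "affine_address c b (i ## \<omega>) = c i * affine_address c b \<omega> + b i"
proof -
  have summ: "summable (\<lambda>k. (\<Prod>j<k. c (\<omega> !! j)) * b (\<omega> !! k))" for \<omega>
    by (rule summable_comparison_test'[where N = 0, OF summable_geometric_bound])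
       (rule affine_address_term_le)
  let ?g = "\<lambda>k. (\<Prod>j<k. c ((i ## \<omega>) !! j)) * b ((i ## \<omega>) !! k)"
  have "affine_address c b (i ## \<omega>) = (\<Sum>k. ?g (Suc k)) + b i"
    unfolding affine_address_def by (subst suminf_split_head[OF summ]) simp
  also have "(\<Sum>k. ?g (Suc k)) = (\<Sum>k. c i * ((\<Prod>j<k. c (\<omega> !! j)) * b (\<omega> !! k)))"
    by (simp del: prod.lessThan_Suc add: prod.lessThan_Suc_shift mult.assoc)
  also have "\<dots> = c i * affine_address c b \<omega>"
    unfolding affine_address_def by (rule suminf_mult[OF summ])
  finally show ?thesis .
qed

end

lemma borel_measurable_affine_address [measurable]:
  fixes q :: "'i pmf"
  shows "affine_address c b \<in> borel_measurable (stream_space (measure_pmf q))"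
proof -
  have [measurable]: "c \<in> borel_measurable (measure_pmf q)" "b \<in> borel_measurable (measure_pmf q)"
    by auto
  show ?thesis
    unfolding affine_address_def by measurable
qed

lemma equilibrium_measure_exists:
  fixes p c b :: "'i \<Rightarrow> real"
  assumes I: "finite I" "\<And>i. i \<in> I \<Longrightarrow> 0 < p i" "(\<Sum>i\<in>I. p i) = 1"
    and \<tau>: "\<And>i x. i \<in> I \<Longrightarrow> \<tau> i x = c i * x + b i"
    and c: "\<And>i. i \<in> I \<Longrightarrow> \<bar>c i\<bar> < 1"
  shows "\<exists>\<mu>. equilibrium_measure I p \<tau> \<mu> \<and> finite_moments \<mu>"
proof -
  obtain C where C: "0 \<le> C" "C < 1" "\<And>i. i \<in> I \<Longrightarrow> \<bar>c i\<bar> \<le> C"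
    using obtain_contraction_bound[where c = c, OF I(1) c] by blast
  \<comment> \<open>Truncating outside \<open>I\<close> makes the coefficients bounded on the whole index type, so that the
    address series converges at every stream, not only almost surely.\<close>
  define c' where "c' i = (if i \<in> I then c i else 0)" for i
  define b' where "b' i = (if i \<in> I then b i else 0)" for i
  define B where "B = (\<Sum>i\<in>I. \<bar>b i\<bar>)"
  have c': "\<bar>c' i\<bar> \<le> C" for i
    using C by (simp add: c'_def)
  have b': "\<bar>b' i\<bar> \<le> B" for i
    using I(1) by (auto simp: b'_def B_def sum_nonneg intro!: member_le_sum)
  obtain q where q: "set_pmf q = I" "\<And>i. i \<in> I \<Longrightarrow> pmf q i = p i"
    using obtain_pmf_with_weights I by metis
  define S where "S = stream_space (measure_pmf q)"
  interpret S: prob_space S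
    unfolding S_def by (rule prob_space.prob_space_stream_space) (rule measure_pmf.prob_space_axioms)
  let ?X = "affine_address c' b'"
  have X [measurable]: "?X \<in> borel_measurable S"
    by (simp add: S_def)
  define \<mu> where "\<mu> = distr S borel ?X"
  have \<mu>: "real_distribution \<mu>"
    unfolding \<mu>_def by (intro S.real_distribution_distr) simp
  interpret real_distribution \<mu> by fact
  have space_S: "space S = UNIV"
    by (simp add: S_def space_stream_space)
  have "measure \<mu> E = (\<Sum>i\<in>I. p i * measure (distr \<mu> borel (\<tau> i)) E)"
    if [measurable]: "E \<in> sets borel" for E
  proof -
    have "measure \<mu> E = measure S {\<omega>. ?X \<omega> \<in> E}"
      using space_S by (simp add: \<mu>_def measure_distr vimage_def)
    \<comment> \<open>Condition on the first index: it has law \<open>q\<close>, and the remaining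
      sequence is independent of it with law \<open>S\<close> again.\<close>
    also have "\<dots> = (\<integral>i. measure S {\<omega>. ?X (i ## \<omega>) \<in> E} \<partial>measure_pmf q)"
      using prob_space.prob_stream_space[OF measure_pmf.prob_space_axioms[of q],
          of "\<lambda>\<omega>. ?X \<omega> \<in> E"] space_S
      by (subst integral_eq_nn_integral) (auto simp: S_def dest!: arg_cong[where f = enn2real])
    also have "\<dots> = (\<Sum>i\<in>I. p i * measure S {\<omega>. c' i * ?X \<omega> + b' i \<in> E})"
      using I(1) q
      by (subst integral_measure_pmf[of I]) (auto simp: affine_address_Stream[OF C(2) c' b'])
    also have "\<dots> = (\<Sum>i\<in>I. p i * measure (distr \<mu> borel (\<tau> i)) E)"
    proof (intro sum.cong refl arg_cong[where f = "(*) _"])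
      fix i assume i: "i \<in> I"
      have [measurable]: "\<tau> i \<in> borel_measurable borel"
        using \<tau>[OF i] by (simp add: measurable_cong[of borel "\<tau> i"])
      have "distr \<mu> borel (\<tau> i) = distr S borel (\<lambda>\<omega>. \<tau> i (?X \<omega>))"
        unfolding \<mu>_def by (subst distr_distr) (auto simp: comp_def)
      then show "measure S {\<omega>. c' i * ?X \<omega> + b' i \<in> E} = measure (distr \<mu> borel (\<tau> i)) E"
        using space_S i by (simp add: measure_distr vimage_def \<tau> c'_def b'_def)
    qed
    finally show ?thesis .
  qed
  then have "equilibrium_measure I p \<tau> \<mu>"
    using \<mu> by (simp add: equilibrium_measure_def)
  moreover have "finite_moments \<mu>"
    unfolding finite_moments_def
  proof
    fix k :: nat
    have "\<bar>?X \<omega> ^ k\<bar> \<le> (\<Sum>k. B * C ^ k) ^ k" for \<omega>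
      using abs_affine_address_le[OF C(2) c' b', where \<omega> = \<omega>] by (simp add: power_abs power_mono)
    then have "integrable S (\<lambda>\<omega>. ?X \<omega> ^ k)"
      by (intro S.integrable_const_bound[where B = "(\<Sum>k. B * C ^ k) ^ k"]) auto
    then show "integrable \<mu> (\<lambda>x. x ^ k)"
      unfolding \<mu>_def by (subst integrable_distr_eq) auto
  qed
  ultimately show ?thesis by blast
qed

section \<open>The moment matrix transformation\<close>

text \<open>By the binomial theorem, column \<open>n\<close> of \<open>affine_matrix c b\<close>
  lists the coefficients of \<open>(c * x + b) ^ n\<close> in powers of \<open>x\<close>. Expanding
  both factors and integrating termwise produces the entries of the triple matrix product.\<close>

lemma integral_affine_power_mult:
  assumes "finite_moments \<nu>"
  shows "(\<integral>x. (c * x + b) ^ m * (c * x + b) ^ n \<partial>\<nu>) =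
    (\<Sum>l\<le>n. \<Sum>k\<le>m. affine_matrix c b k m * moment_matrix \<nu> k l * affine_matrix c b l n)"
proof -
  have pow: "(c * x + b) ^ n = (\<Sum>k\<le>n. affine_matrix c b k n * x ^ k)" for x n
    unfolding binomial_ring by (intro sum.cong) (auto simp: affine_matrix_def power_mult_distrib)
  have int: "integrable \<nu> (\<lambda>x. x ^ k)" for k
    using assms by (simp add: finite_moments_def)
  have "(\<integral>x. (c * x + b) ^ m * (c * x + b) ^ n \<partial>\<nu>) = (\<integral>x. (\<Sum>l\<le>n. \<Sum>k\<le>m.
      affine_matrix c b k m * affine_matrix c b l n * x ^ (k + l)) \<partial>\<nu>)"
    unfolding pow sum_product
    by (subst sum.swap) (simp add: power_add mult_ac)
  also have "\<dots> = (\<Sum>l\<le>n. \<Sum>k\<le>m. affine_matrix c b k m * affine_matrix c b l n *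
      (\<integral>x. x ^ (k + l) \<partial>\<nu>))"
    by (simp add: int)
  finally show ?thesis
    by (simp add: moment_matrix_def mult_ac)
qed

lemma moment_transform_moment_matrix:
  assumes "finite_moments \<nu>" "\<And>i. i \<in> I \<Longrightarrow> A i = affine_matrix (c i) (b i)"
  shows "moment_transform I p A (moment_matrix \<nu>) m n =
    (\<Sum>i\<in>I. p i * (\<integral>x. (c i * x + b i) ^ (m + n) \<partial>\<nu>))"
  unfolding moment_transform_def
proof (intro sum.cong refl arg_cong[where f = "(*) _"])
  fix i assume "i \<in> I"
  let ?A = "affine_matrix (c i) (b i)"
  \<comment> \<open>Upper triangularity cuts the series off at the index \<open>k\<close>; the same
    holds for the right factor below.\<close>
  have "imat_mult (imat_adjoint ?A) M k l = (\<Sum>j\<le>k. ?A j k * M j l)" for M k l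
    unfolding imat_mult_def imat_adjoint_def
    by (rule suminf_finite) (auto simp: affine_matrix_def)
  moreover have "imat_mult M ?A k l = (\<Sum>j\<le>l. M k j * ?A j l)" for M k l
    unfolding imat_mult_def by (rule suminf_finite) (auto simp: affine_matrix_def)
  ultimately show "imat_mult (imat_mult (imat_adjoint (A i)) (moment_matrix \<nu>)) (A i) m n =
      (\<integral>x. (c i * x + b i) ^ (m + n) \<partial>\<nu>)"
    using assms(2)[OF \<open>i \<in> I\<close>] integral_affine_power_mult[OF assms(1), of "c i" "b i" m n]
    by (simp add: power_add sum_distrib_right)
qed

section \<open>Uniqueness of the invariant moments\<close>

lemma weighted_powers_less_one:
  fixes p c :: "'i \<Rightarrow> real"
  assumes I: "finite I" "\<And>i. i \<in> I \<Longrightarrow> 0 < p i" "(\<Sum>i\<in>I. p i) = 1"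
    and c: "\<And>i. i \<in> I \<Longrightarrow> \<bar>c i\<bar> < 1" and k: "0 < k"
  shows "(\<Sum>i\<in>I. p i * c i ^ k) < 1"
proof -
  have "c i ^ k < 1" if "i \<in> I" for i
  proof -
    have "c i ^ k \<le> \<bar>c i\<bar> ^ k" by (simp flip: power_abs)
    also have "\<dots> < 1" using c[OF that] k by (simp add: power_less_one_iff)
    finally show ?thesis .
  qed
  \<comment> \<open>The strict inequality between sums needs at least one index; an empty family
    would have total weight 0.\<close>
  moreover have "I \<noteq> {}" using I(3) by auto
  ultimately have "(\<Sum>i\<in>I. p i * c i ^ k) < (\<Sum>i\<in>I. p i * 1)"
    using I by (intro sum_strict_mono mult_strict_left_mono) auto
  then show ?thesis using I(3) by simp
qed

text \<open>Strong induction on the order: once the top-degree terms are moved to the left, the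
  right side involves only lower moments, and the factor on the left can be cancelled.\<close>

lemma invariant_moments_unique:
  fixes p c b :: "'i \<Rightarrow> real"
  assumes I: "finite I" "\<And>i. i \<in> I \<Longrightarrow> 0 < p i" "(\<Sum>i\<in>I. p i) = 1"
    and c: "\<And>i. i \<in> I \<Longrightarrow> \<bar>c i\<bar> < 1"
    and \<mu>: "real_distribution \<mu>" "finite_moments \<mu>"
      "\<And>k. (\<integral>x. x ^ k \<partial>\<mu>) = (\<Sum>i\<in>I. p i * (\<integral>x. (c i * x + b i) ^ k \<partial>\<mu>))"
    and \<nu>: "real_distribution \<nu>" "finite_moments \<nu>"
      "\<And>k. (\<integral>x. x ^ k \<partial>\<nu>) = (\<Sum>i\<in>I. p i * (\<integral>x. (c i * x + b i) ^ k \<partial>\<nu>))"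
  shows "(\<integral>x. x ^ k \<partial>\<mu>) = (\<integral>x. x ^ k \<partial>\<nu>)"
proof (induction k rule: less_induct)
  case (less k)
  show ?case
  proof (cases "k = 0")
    \<comment> \<open>For \<open>k = 0\<close> that factor would be 0; the value comes from the
      total mass 1 instead.\<close>
    case True
    interpret \<mu>: real_distribution \<mu> by fact
    interpret \<nu>: real_distribution \<nu> by fact
    show ?thesis
      using True \<mu>.prob_space \<nu>.prob_space by simp
  next
    case False
    let ?s = "\<Sum>i\<in>I. p i * c i ^ k"
    let ?L = "\<lambda>\<kappa>. \<Sum>i\<in>I. p i * (\<Sum>l<k. (\<integral>x. x ^ l \<partial>\<kappa>) * affine_matrix (c i) (b i) l k)"
    have split: "(1 - ?s) * (\<integral>x. x ^ k \<partial>\<kappa>) = ?L \<kappa>"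
      if "finite_moments \<kappa>"
        "(\<integral>x. x ^ k \<partial>\<kappa>) = (\<Sum>i\<in>I. p i * (\<integral>x. (c i * x + b i) ^ k \<partial>\<kappa>))" for \<kappa>
    proof -
      have "(\<integral>x. (c i * x + b i) ^ k \<partial>\<kappa>) = (\<Sum>l<k. (\<integral>x. x ^ l \<partial>\<kappa>) * affine_matrix (c i) (b i) l k)
          + (\<integral>x. x ^ k \<partial>\<kappa>) * c i ^ k" for i
        \<comment> \<open>With \<open>m = 0\<close> the first power is 1, leaving a single sum over
          \<open>l\<close>. Its last summand \<open>l = k\<close> has coefficient
          \<open>c i ^ k\<close> and is split off.\<close>
        using integral_affine_power_mult[OF that(1), of "c i" "b i" 0 k]
        by (simp add: affine_matrix_def moment_matrix_def flip: lessThan_Suc_atMost)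
      then have "(\<Sum>i\<in>I. p i * (\<integral>x. (c i * x + b i) ^ k \<partial>\<kappa>)) = ?L \<kappa> + ?s * (\<integral>x. x ^ k \<partial>\<kappa>)"
        by (simp add: distrib_left sum.distrib sum_distrib_left mult_ac)
      then have "(\<integral>x. x ^ k \<partial>\<kappa>) = ?L \<kappa> + ?s * (\<integral>x. x ^ k \<partial>\<kappa>)"
        using that(2) by (rule trans[rotated])
      then show ?thesis unfolding left_diff_distrib by linarith
    qed
    have "?L \<mu> = ?L \<nu>"
      using less.IH by simp
    then have "(1 - ?s) * (\<integral>x. x ^ k \<partial>\<mu>) = (1 - ?s) * (\<integral>x. x ^ k \<partial>\<nu>)"
      using split[OF \<mu>(2,3)] split[OF \<nu>(2,3)] by simp
    then show ?thesis
      using weighted_powers_less_one[where c = c and k = k, OF I c] False by simp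
  qed
qed

section \<open>The fixed point and its identification with the equilibrium measure\<close>

theorem corollary3p4:
  fixes I :: "'i set" and c b p :: "'i \<Rightarrow> real" and \<tau> :: "'i \<Rightarrow> real \<Rightarrow> real"
    and A :: "'i \<Rightarrow> imat" and \<mu> :: "real measure"
  assumes "finite I"
    and "\<And>i x. i \<in> I \<Longrightarrow> \<tau> i x = c i * x + b i"
    and "\<And>i. i \<in> I \<Longrightarrow> \<bar>c i\<bar> < 1"
    and "\<And>i. i \<in> I \<Longrightarrow> p i \<in> {0<..<1}"
    and "(\<Sum>i\<in>I. p i) = 1"
    and "\<And>i. i \<in> I \<Longrightarrow> A i = affine_matrix (c i) (b i)"
    and "\<mu> = hutchinson_measure I p \<tau>"
  shows "(\<exists>!M. M \<in> moment_matrices \<and> moment_transform I p A M = M) \<and>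
         (real_distribution \<mu> \<and> finite_moments \<mu> \<and>
          moment_transform I p A (moment_matrix \<mu>) = moment_matrix \<mu>)"
proof -
  note \<tau> = assms(2) and c = assms(3) and A = assms(6)
  have I: "finite I" "\<And>i. i \<in> I \<Longrightarrow> 0 < p i" "(\<Sum>i\<in>I. p i) = 1"
    using assms by auto
  obtain \<mu>' where \<mu>': "equilibrium_measure I p \<tau> \<mu>'" "finite_moments \<mu>'"
    using equilibrium_measure_exists[where \<tau> = \<tau> and c = c and b = b, OF I \<tau> c] by blast
  \<comment> \<open>Existence and uniqueness together ensure that the definite description denotes
    the constructed measure.\<close>
  have "\<mu> = \<mu>'"
    unfolding assms(7) hutchinson_measure_def
    using \<mu>'(1) equilibrium_measure_unique[where \<tau> = \<tau> and c = c and b = b, OF I \<tau> c]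
    by (intro the_equality) auto
  then have \<mu>: "equilibrium_measure I p \<tau> \<mu>" "real_distribution \<mu>" "finite_moments \<mu>"
    using \<mu>' by (auto simp: equilibrium_measure_def)
  have moments: "(\<integral>x. x ^ k \<partial>\<mu>) = (\<Sum>i\<in>I. p i * (\<integral>x. (c i * x + b i) ^ k \<partial>\<mu>))" for k
    using integral_equilibrium_measure[where \<tau> = \<tau> and c = c and b = b and f = "\<lambda>x. x ^ k",
        OF I \<tau> \<mu>(1)] \<mu>(3) \<tau>
    by (simp add: finite_moments_def)
  have fixed: "moment_transform I p A (moment_matrix \<mu>) = moment_matrix \<mu>"
    using moment_transform_moment_matrix[where c = c and b = b and p = p, OF \<mu>(3) A] moments
    by (intro ext) (simp add: moment_matrix_def)
  have "M = moment_matrix \<mu>"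
    if "M \<in> moment_matrices" and M: "moment_transform I p A M = M" for M
  proof -
    obtain \<nu> where \<nu>: "M = moment_matrix \<nu>" "real_distribution \<nu>" "finite_moments \<nu>"
      using \<open>M \<in> moment_matrices\<close> by (auto simp: moment_matrices_def)
    \<comment> \<open>Row 0 of the matrix equation already contains the invariance of every
      moment.\<close>
    have "(\<integral>x. x ^ k \<partial>\<nu>) = (\<Sum>i\<in>I. p i * (\<integral>x. (c i * x + b i) ^ k \<partial>\<nu>))" for k
      using fun_cong[OF fun_cong[OF M], of 0 k]
        moment_transform_moment_matrix[where c = c and b = b and p = p and m = 0 and n = k, OF \<nu>(3) A]
      by (simp add: \<nu>(1) moment_matrix_def)
    then have "(\<integral>x. x ^ k \<partial>\<nu>) = (\<integral>x. x ^ k \<partial>\<mu>)" for k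
      using invariant_moments_unique[where c = c and b = b, OF I c \<nu>(2,3) _ \<mu>(2,3) moments] by blast
    \<comment> \<open>Each entry of a moment matrix is a moment of order \<open>m + n\<close>, so
      equal moments give equal matrices.\<close>
    then show ?thesis
      by (simp add: \<nu>(1) moment_matrix_def)
  qed
  moreover have "moment_matrix \<mu> \<in> moment_matrices"
    using \<mu> by (auto simp: moment_matrices_def)
  ultimately show ?thesis
    using fixed \<mu> by blast
qed

end
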